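(* Let $N_t$ be the Galton–Watson process in the i.i.d. random environment $\omega=(p_t,\alpha_t)_{t\ge1}$ with generalized geometric offspring laws. If $\mathcal{E}\ln\frac{\beta_1}{p_1}=0$ and $\sigma^2=\mathcal{E}\ln^2\frac{\beta_1}{p_1}<\infty$, then for $P_m$-almost every environment $\omega$, $$S_\infty(\omega)=1+\sum_{i=1}^{\infty}\frac{1-\beta_i}{\beta_i}\prod_{j=1}^{i-1}\frac{p_j}{\beta_j}=\infty ,$$ and the process dies out $P^\omega$-almost surely: there is a $P^\omega$-a.s. finite random time $\tau$ such that $N_t=0$ for all $t\ge\tau$.
   Context: Environment: $(p_t,\alpha_t)$, $t\ge1$, are i.i.d. random vectors with values in $(0,1)^2$ ($p_t$ and $\alpha_t$ with the same $t$ may be dependent); $\beta_t=1-\alpha_t$; $\omega=(p_t,\alpha_t)_{t\ge1}$; $P_m$ is the law of the environment. $\mathcal{E}$ denotes total (annealed) expectation, which for functions of the environment is expectation under $P_m$. Given $\omega$, $N_0=1$ and $N_t=\sum_{i=1}^{N_{t-1}}\xi_{t,i}$, where under the quenched (conditional given $\omega$) law $P^\omega$ all $\xi_{t,i}$ are independent with $P^\omega(\xi_{t,i}=0)=\alpha_t$, $P^\omega(\xi_{t,i}=k)=(1-\alpha_t)p_t(1-p_t)^{k-1}$ for $k\ge1$. Empty products equal $1$. *)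

theory Defs
  imports "HOL-Probability.Probability"
begin

text \<open>
  The environment is carried by an arbitrary probability space; the canonical choice is the
  sequence space with its coordinate projections. Time starts at 1, so the values
  \<open>p 0\<close> and \<open>\<alpha> 0\<close> are junk and are never used.
\<close>

locale iid_environment = prob_space Pm for Pm :: "'e measure" +
  fixes p \<alpha> :: "nat \<Rightarrow> 'e \<Rightarrow> real"
  assumes p_range: "\<And>t \<omega>. 1 \<le> t \<Longrightarrow> \<omega> \<in> space Pm \<Longrightarrow> p t \<omega> \<in> {0<..<1}"
    and \<alpha>_range: "\<And>t \<omega>. 1 \<le> t \<Longrightarrow> \<omega> \<in> space Pm \<Longrightarrow> \<alpha> t \<omega> \<in> {0<..<1}"
    and indep_env: "indep_vars (\<lambda>_. borel) (\<lambda>t \<omega>. (p t \<omega>, \<alpha> t \<omega>)) {1..}"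
    and ident_env: "\<And>t. 1 \<le> t \<Longrightarrow>
      distr Pm borel (\<lambda>\<omega>. (p t \<omega>, \<alpha> t \<omega>)) = distr Pm borel (\<lambda>\<omega>. (p 1 \<omega>, \<alpha> 1 \<omega>))"

text \<open>
  Here \<open>p\<close> and \<open>\<alpha>\<close> are a single realisation of the environment, and \<open>Q\<close> is the quenched
  law given that realisation.
\<close>

locale quenched_offspring = prob_space Q for Q :: "'w measure" +
  fixes p \<alpha> :: "nat \<Rightarrow> real" and \<xi> :: "nat \<Rightarrow> nat \<Rightarrow> 'w \<Rightarrow> nat"
  assumes indep_offspring:
      "indep_vars (\<lambda>_. count_space UNIV) (\<lambda>(t, i). \<xi> t i) ({1..} \<times> {1..})"
    and offspring_0: "\<And>t i. 1 \<le> t \<Longrightarrow> 1 \<le> i \<Longrightarrow> prob {x \<in> space Q. \<xi> t i x = 0} = \<alpha> t"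
    and offspring_pos: "\<And>t i k. 1 \<le> t \<Longrightarrow> 1 \<le> i \<Longrightarrow> 1 \<le> k \<Longrightarrow>
      prob {x \<in> space Q. \<xi> t i x = k} = (1 - \<alpha> t) * p t * (1 - p t) ^ (k - 1)"

primrec gw_process :: "(nat \<Rightarrow> nat \<Rightarrow> 'w \<Rightarrow> nat) \<Rightarrow> nat \<Rightarrow> 'w \<Rightarrow> nat" where
  "gw_process \<xi> 0 x = 1"
| "gw_process \<xi> (Suc t) x = (\<Sum>i=1..gw_process \<xi> t x. \<xi> (Suc t) i x)"

text \<open>
  The library sum \<open>\<Sum>i\<close> starts at 0, so its summand at \<open>i\<close> is the term of index \<open>Suc i\<close>
  of the series. The values lie in \<open>[0, \<infinity>]\<close>: for \<open>p\<close> and \<open>\<beta>\<close> with values in \<open>(0, 1)\<close> all terms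
  are positive, so \<open>ennreal\<close> does not truncate them.
\<close>

definition S_infty :: "(nat \<Rightarrow> real) \<Rightarrow> (nat \<Rightarrow> real) \<Rightarrow> ennreal" where
  "S_infty p \<beta> =
     1 + (\<Sum>i. ennreal ((1 - \<beta> (Suc i)) / \<beta> (Suc i) * (\<Prod>j=1..i. p j / \<beta> j)))"

definition dies_out_as :: "'w measure \<Rightarrow> (nat \<Rightarrow> 'w \<Rightarrow> nat) \<Rightarrow> bool" where
  "dies_out_as Q N \<longleftrightarrow>
     (\<exists>\<tau> :: 'w \<Rightarrow> enat. \<tau> \<in> measurable Q (count_space UNIV) \<and>
        (AE x in Q. \<tau> x < \<infinity>) \<and>
        (\<forall>x\<in>space Q. \<forall>t. \<tau> x \<le> enat t \<longrightarrow> N t x = 0))"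

end

theory Submission
  imports Defs
begin

text \<open>
  Quenched part: on the odds scale \<open>s / (1 - s)\<close> the generating function of a generalized
  geometric law acts as the affine map \<open>u \<mapsto> \<alpha>/\<beta> + (p/\<beta>) u\<close>. Composing these maps gives
  \<open>1 / P(N\<^sub>n > 0)\<close> as the partial sum of \<open>S\<^sub>\<infinity>\<close>, so \<open>S\<^sub>\<infinity> = \<infinity>\<close> forces extinction.

  Environment part: write \<open>T = S\<^sub>\<infinity> - 1\<close> and \<open>X = ln (\<beta>\<^sub>1 / p\<^sub>1)\<close>. Then
  \<open>T = \<alpha>\<^sub>1/\<beta>\<^sub>1 + exp (-X) T'\<close>, where \<open>T'\<close> has the law of \<open>T\<close> and is independent of \<open>X\<close>. On
  \<open>{T < \<infinity>} = {T' < \<infinity>}\<close> this gives \<open>ln T - ln T' + X > 0\<close>. But \<open>ln T - ln T'\<close>, set to 0 off this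
  event, is bounded below by \<open>- |X|\<close>, hence integrable with mean zero because the two terms have
  the same law; mean zero also holds for \<open>X\<close> restricted to
  \<open>{T' < \<infinity>}\<close> by independence. Hence the event is null.
\<close>

section \<open>Reindexing independent families and splitting expectations along a discrete
  variable\<close>

text \<open>Injectivity makes the blocks \<open>{h j}\<close> disjoint, so the restrictions to them
  are independent; evaluating each at its only coordinate gives the claim.\<close>

lemma (in prob_space) indep_vars_reindex:
  assumes indep: "indep_vars M' X I" and inj: "inj_on h J" and sub: "h ` J \<subseteq> I"
  shows "indep_vars (M' \<circ> h) (X \<circ> h) J"
proof -
  have "indep_vars (\<lambda>j. PiM {h j} M') (\<lambda>j \<omega>. \<lambda>i\<in>{h j}. X i \<omega>) J"
    by (rule indep_vars_restrict[OF indep])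
      (use inj sub in \<open>auto simp: disjoint_family_on_def inj_on_def\<close>)
  then have "indep_vars (\<lambda>j. M' (h j)) (\<lambda>j \<omega>. (\<lambda>i\<in>{h j}. X i \<omega>) (h j)) J"
    by (rule indep_vars_compose2) auto
  then show ?thesis by (simp add: comp_def)
qed

lemma measurable_sum_count_space:
  fixes f :: "'i \<Rightarrow> 'a \<Rightarrow> 'b::{comm_monoid_add, countable}"
  assumes "\<And>i. i \<in> I \<Longrightarrow> f i \<in> measurable M (count_space UNIV)"
  shows "(\<lambda>x. \<Sum>i\<in>I. f i x) \<in> measurable M (count_space UNIV)"
  using assms by (induction I rule: infinite_finite_induct) auto

text \<open>The n-th partial sum is the expectation of \<open>g\<close> cut off to
  \<open>N < n\<close>, so dominated convergence with bound \<open>norm (g x)\<close>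
  applies.\<close>

lemma (in prob_space) expectation_partition_nat:
  fixes N :: "'a \<Rightarrow> nat" and g :: "'a \<Rightarrow> real"
  assumes N[measurable]: "N \<in> measurable M (count_space UNIV)" and g: "integrable M g"
  shows "(\<lambda>k. expectation (\<lambda>x. indicator {k} (N x) * g x)) sums expectation g"
proof -
  have [measurable]: "g \<in> borel_measurable M" using g by simp
  have int: "integrable M (\<lambda>x. indicator {k} (N x) * g x)" for k
    by (rule Bochner_Integration.integrable_bound[OF g]) (auto simp: indicator_def)
  have part: "(\<Sum>k<n. indicator {k} (N x) * g x) = (if N x < n then g x else 0)" for n x
    by (induction n) (auto simp: indicator_def less_Suc_eq)
  have "(\<lambda>n. expectation (\<lambda>x. \<Sum>k<n. indicator {k} (N x) * g x)) \<longlonglongrightarrow> expectation g"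
  proof (rule integral_dominated_convergence[where w = "\<lambda>x. norm (g x)"])
    show "AE x in M. (\<lambda>n. \<Sum>k<n. indicator {k} (N x) * g x) \<longlonglongrightarrow> g x"
      unfolding part
      by (intro always_eventually allI tendsto_eventually eventually_mono[OF eventually_gt_at_top]) auto
  qed (use g in \<open>auto simp: part\<close>)
  then show ?thesis
    unfolding sums_def by (subst (asm) Bochner_Integration.integral_sum) (use int in auto)
qed

section \<open>Generating functions of generalized geometric laws on the odds scale\<close>

definition odds :: "real \<Rightarrow> real" where "odds s = s / (1 - s)"

definition gen_geometric_pgf :: "real \<Rightarrow> real \<Rightarrow> real \<Rightarrow> real" where
  "gen_geometric_pgf p a s = a + (1 - a) * p * s / (1 - (1 - p) * s)"

text \<open>Needed to iterate \<open>odds_gen_geometric_pgf\<close>, which is restricted to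
  arguments in [0,1). The upper bound comes from factoring 1 minus the value.\<close>

lemma gen_geometric_pgf_range:
  assumes "p \<in> {0<..<1}" "a \<in> {0<..<1}" "s \<in> {0..<1}"
  shows "gen_geometric_pgf p a s \<in> {0..<1}"
proof -
  have d: "(1 - p) * s < 1" using assms mult_strict_mono[of "1-p" 1 s 1] by auto
  have "1 - gen_geometric_pgf p a s = (1 - a) * (1 - s) / (1 - (1 - p) * s)"
    using d by (simp add: gen_geometric_pgf_def field_simps)
  also have "\<dots> > 0" using assms d by simp
  finally show ?thesis
    using assms d by (auto simp: gen_geometric_pgf_def)
qed

text \<open>The generating function is fractional linear and fixes 1, the pole of
  \<open>odds\<close>; in the odds coordinate it therefore fixes infinity and is affine. In the
  computation the common denominator of the value and its complement cancels.\<close>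

lemma odds_gen_geometric_pgf:
  assumes "p \<in> {0<..<1}" "a \<in> {0<..<1}" "s \<in> {0..<1}"
  shows "odds (gen_geometric_pgf p a s) = a / (1 - a) + p / (1 - a) * odds s"
proof -
  have "(1 - p) * s < 1" using assms mult_strict_mono[of "1-p" 1 s 1] by auto
  then have d: "1 - (1 - p) * s \<noteq> 0" by simp
  have "1 - gen_geometric_pgf p a s = (1 - a) * (1 - s) / (1 - (1 - p) * s)"
    using d by (simp add: gen_geometric_pgf_def field_simps)
  moreover have "gen_geometric_pgf p a s = (a * (1 - (1 - p) * s) + (1 - a) * p * s) / (1 - (1 - p) * s)"
    using d by (simp add: gen_geometric_pgf_def field_simps)
  ultimately have "odds (gen_geometric_pgf p a s) =
      (a * (1 - (1 - p) * s) + (1 - a) * p * s) / ((1 - a) * (1 - s))"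
    using d by (simp add: odds_def)
  also have "\<dots> = (a * (1 - s) + p * s) / ((1 - a) * (1 - s))"
    by (simp add: algebra_simps)
  also have "\<dots> = a / (1 - a) + p / (1 - a) * odds s"
    using assms by (simp add: odds_def add_divide_distrib)
  finally show ?thesis .
qed

text \<open>The values k \<ge> 1 contribute a geometric series with ratio
  \<open>(1 - p) * s\<close>; the atom at 0 is put back by \<open>sums_Suc\<close>.\<close>

lemma (in prob_space) expectation_power_gen_geometric:
  assumes X[measurable]: "X \<in> measurable M (count_space UNIV)"
    and p: "p \<in> {0<..<1}" and s: "s \<in> {0..<1::real}"
    and X0: "prob {x \<in> space M. X x = 0} = a"
    and Xk: "\<And>k. 1 \<le> k \<Longrightarrow> prob {x \<in> space M. X x = k} = (1 - a) * p * (1 - p) ^ (k - 1)"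
  shows "expectation (\<lambda>x. s ^ X x) = gen_geometric_pgf p a s"
proof -
  have d: "(1 - p) * s < 1" using p s mult_strict_mono[of "1-p" 1 s 1] by auto
  have "integrable M (\<lambda>x. s ^ X x)"
    by (rule integrable_const_bound[where B = 1]) (use s in \<open>auto intro!: power_le_one\<close>)
  from expectation_partition_nat[OF X this]
  have "(\<lambda>k. expectation (\<lambda>x. indicator {k} (X x) * s ^ X x)) sums expectation (\<lambda>x. s ^ X x)" .
  also have "(\<lambda>k. expectation (\<lambda>x. indicator {k} (X x) * s ^ X x))
      = (\<lambda>k. s ^ k * prob {x \<in> space M. X x = k})"
  proof
    fix k
    have "expectation (\<lambda>x. indicator {k} (X x) * s ^ X x)
        = expectation (\<lambda>x. s ^ k * indicator {x \<in> space M. X x = k} x)"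
      by (rule Bochner_Integration.integral_cong) (auto simp: indicator_def)
    then show "expectation (\<lambda>x. indicator {k} (X x) * s ^ X x) = s ^ k * prob {x \<in> space M. X x = k}"
      by simp
  qed
  finally have 1: "(\<lambda>k. s ^ k * prob {x \<in> space M. X x = k}) sums expectation (\<lambda>x. s ^ X x)" .
  have "(\<lambda>k. ((1 - p) * s) ^ k) sums (1 / (1 - (1 - p) * s))"
    using d p s by (intro geometric_sums) (simp add: abs_mult)
  from sums_mult[OF this, of "(1 - a) * p * s"]
  have "(\<lambda>k. s ^ Suc k * prob {x \<in> space M. X x = Suc k}) sums ((1 - a) * p * s / (1 - (1 - p) * s))"
    by (simp add: Xk power_mult_distrib mult_ac)
  then have "(\<lambda>k. s ^ k * prob {x \<in> space M. X x = k}) sums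
     ((1 - a) * p * s / (1 - (1 - p) * s) + s ^ 0 * prob {x \<in> space M. X x = 0})"
    by (rule sums_Suc)
  from sums_unique2[OF 1 this] show ?thesis
    by (simp add: X0 gen_geometric_pgf_def)
qed

text \<open>On the event \<open>N x = k\<close> the random sum has the fixed length k, so
  independence turns its contribution into \<open>f ^ k\<close> times the probability of the event.
  Both expectations thus agree term by term in their partition along \<open>N\<close>.\<close>

lemma (in prob_space) expectation_power_random_sum:
  fixes N :: "'a \<Rightarrow> nat" and X :: "nat \<Rightarrow> 'a \<Rightarrow> nat" and s f :: real
  assumes indep_N: "\<And>k. indep_var (count_space UNIV) N (count_space UNIV) (\<lambda>x. \<Sum>i=1..k. X i x)"
    and indep: "indep_vars (\<lambda>_. count_space UNIV) X {1..}"
    and s: "s \<in> {0..1}"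
    and f: "\<And>i. 1 \<le> i \<Longrightarrow> expectation (\<lambda>x. s ^ X i x) = f"
  shows "expectation (\<lambda>x. s ^ (\<Sum>i=1..N x. X i x)) = expectation (\<lambda>x. f ^ N x)"
proof -
  have N[measurable]: "N \<in> measurable M (count_space UNIV)"
    using indep_N[of 0] by (rule indep_var_rv1)
  have X[measurable]: "X i \<in> measurable M (count_space UNIV)" if "1 \<le> i" for i
    using indep that by (auto simp: indep_vars_def)
  have bdd: "integrable M (\<lambda>x. r ^ Y x)"
    if "r \<in> {0..1}" and [measurable]: "Y \<in> measurable M (count_space UNIV)" for Y :: "'a \<Rightarrow> nat" and r :: real
    by (rule integrable_const_bound[where B = 1]) (use that in \<open>auto intro!: power_le_one\<close>)
  have sumX[measurable]: "(\<lambda>x. \<Sum>i=1..k. X i x) \<in> measurable M (count_space UNIV)" for k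
    by (rule measurable_sum_count_space) (auto simp: X)
  have randsum: "(\<lambda>x. \<Sum>i=1..N x. X i x) \<in> measurable M (count_space UNIV)"
    by (rule measurable_compose_countable[OF sumX N])
  \<comment> \<open>That \<open>f\<close> lies in [0,1] is read off from its being such an
    expectation; this makes \<open>f ^ N x\<close> bounded, hence integrable.\<close>
  have "expectation (\<lambda>x. s ^ X 1 x) \<le> expectation (\<lambda>x. 1)"
    using s by (intro integral_mono bdd) (auto intro: power_le_one)
  moreover have "expectation (\<lambda>x. s ^ X 1 x) \<ge> 0" using s by simp
  ultimately have f01: "f \<in> {0..1}" using f[of 1] by (simp add: prob_space)
  have "expectation (\<lambda>x. indicator {k} (N x) * s ^ (\<Sum>i=1..N x. X i x))
      = expectation (\<lambda>x. indicator {k} (N x) * f ^ N x)" for k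
  proof -
    have "indep_var borel (indicat_real {k} \<circ> N) borel ((\<lambda>m. s ^ m) \<circ> (\<lambda>x. \<Sum>i=1..k. X i x))"
      by (rule indep_var_compose[OF indep_N]) auto
    then have ind: "indep_var borel (\<lambda>x. indicat_real {k} (N x))
        borel (\<lambda>x. \<Prod>i=1..k. s ^ X i x)"
      by (simp add: comp_def power_sum)
    have ind2: "indep_vars (\<lambda>_. borel) (\<lambda>i x. s ^ X i x) {1..k}"
      by (rule indep_vars_compose2[OF indep_vars_subset[OF indep]]) auto
    have intX: "integrable M (\<lambda>x. s ^ X i x)" if "i \<in> {1..k}" for i
      using bdd s X that by auto
    have "expectation (\<lambda>x. indicator {k} (N x) * s ^ (\<Sum>i=1..N x. X i x))
        = expectation (\<lambda>x. indicator {k} (N x) * (\<Prod>i=1..k. s ^ X i x))"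
      by (rule Bochner_Integration.integral_cong) (auto simp: indicator_def power_sum)
    also have "\<dots> = expectation (\<lambda>x. indicator {k} (N x)) * expectation (\<lambda>x. \<Prod>i=1..k. s ^ X i x)"
    proof (rule indep_var_lebesgue_integral[OF ind])
      show "integrable M (\<lambda>x. indicat_real {k} (N x))"
        by (rule integrable_const_bound[where B = 1]) (auto intro: indep_var_rv1[OF ind])
      show "integrable M (\<lambda>x. \<Prod>i=1..k. s ^ X i x)"
        by (rule indep_vars_integrable[OF _ ind2 intX]) auto
    qed
    also have "expectation (\<lambda>x. \<Prod>i=1..k. s ^ X i x) = f ^ k"
      by (subst indep_vars_lebesgue_integral[OF _ ind2 intX]) (auto simp: f)
    also have "expectation (\<lambda>x. indicator {k} (N x)) * f ^ k
        = expectation (\<lambda>x. indicator {k} (N x) * f ^ k)" by simp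
    also have "\<dots> = expectation (\<lambda>x. indicator {k} (N x) * f ^ N x)"
      by (rule Bochner_Integration.integral_cong) (auto simp: indicator_def)
    finally show ?thesis .
  qed
  then show ?thesis
    using expectation_partition_nat[OF N bdd[OF s randsum]] expectation_partition_nat[OF N bdd[OF f01 N]]
    by (simp add: sums_iff)
qed

section \<open>The branching process under the quenched law\<close>

text \<open>The points \<open>x\<close> and \<open>y\<close> may lie in different spaces, so a
  process on Q can be identified with one driven by coordinate functions on a product space.\<close>

lemma gw_process_cong:
  assumes "\<And>t i. 1 \<le> t \<Longrightarrow> t \<le> n \<Longrightarrow> 1 \<le> i \<Longrightarrow> \<xi> t i x = \<xi>' t i y"
  shows "gw_process \<xi> n x = gw_process \<xi>' n y"
  using assms by (induction n) (auto intro!: sum.cong)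

lemma gw_process_eq_0_mono:
  assumes "gw_process \<xi> m x = 0" "m \<le> n"
  shows "gw_process \<xi> n x = 0"
  using assms(2,1) by (induction rule: dec_induct) auto

lemma measurable_gw_process:
  assumes "\<And>t i. 1 \<le> t \<Longrightarrow> t \<le> n \<Longrightarrow> 1 \<le> i \<Longrightarrow> \<xi> t i \<in> measurable M (count_space UNIV)"
  shows "gw_process \<xi> n \<in> measurable M (count_space UNIV)"
  using assms
proof (induction n)
  case 0
  have "gw_process \<xi> 0 = (\<lambda>_. 1)" by auto
  then show ?case by simp
next
  case (Suc n)
  have "(\<lambda>x. \<Sum>i=1..k. \<xi> (Suc n) i x) \<in> measurable M (count_space UNIV)" for k
    by (rule measurable_sum_count_space) (auto simp: Suc.prems)
  then have "(\<lambda>x. \<Sum>i=1..gw_process \<xi> n x. \<xi> (Suc n) i x) \<in> measurable M (count_space UNIV)"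
    by (rule measurable_compose_countable) (simp add: Suc)
  moreover have "gw_process \<xi> (Suc n) = (\<lambda>x. \<Sum>i=1..gw_process \<xi> n x. \<xi> (Suc n) i x)" by auto
  ultimately show ?case by simp
qed

context quenched_offspring
begin

lemma measurable_offspring: "1 \<le> t \<Longrightarrow> 1 \<le> i \<Longrightarrow> \<xi> t i \<in> measurable Q (count_space UNIV)"
  using indep_offspring by (auto simp: indep_vars_def)

text \<open>Generation n is a function of the offspring variables with time index at most n, and the
  sum involves only time n + 1: two disjoint index blocks.\<close>

lemma indep_gw_process_offspring:
  "indep_var (count_space UNIV) (gw_process \<xi> n) (count_space UNIV) (\<lambda>x. \<Sum>i=1..k. \<xi> (Suc n) i x)"
proof -
  let ?A = "{1..n} \<times> {1..}" and ?B = "{Suc n} \<times> {1..}"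
  have AB: "?A \<inter> ?B = {}" "?A \<subseteq> {1..} \<times> {1..}" "?B \<subseteq> {1..} \<times> {1..}" by auto
  let ?C = "\<lambda>_ :: nat \<times> nat. count_space (UNIV :: nat set)"
  \<comment> \<open>The coordinate functions: \<open>gw_process \<zeta> n\<close> is then the
    measurable functional that expresses generation n through the first block.\<close>
  define \<zeta> :: "nat \<Rightarrow> nat \<Rightarrow> (nat \<times> nat \<Rightarrow> nat) \<Rightarrow> nat" where "\<zeta> t i z = z (t, i)" for t i z
  have m\<zeta>: "\<zeta> t i \<in> measurable (PiM J ?C) (count_space UNIV)" if "(t, i) \<in> J" for t i J
    unfolding \<zeta>_def by (rule measurable_component_singleton[OF that])
  have "indep_var (PiM ?A ?C) (\<lambda>x. \<lambda>(t, i)\<in>?A. \<xi> t i x) (PiM ?B ?C) (\<lambda>x. \<lambda>(t, i)\<in>?B. \<xi> t i x)"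
    using indep_var_restrict[OF indep_offspring AB] by (simp add: case_prod_unfold)
  then have "indep_var (count_space UNIV) (gw_process \<zeta> n \<circ> (\<lambda>x. \<lambda>(t, i)\<in>?A. \<xi> t i x))
      (count_space UNIV) ((\<lambda>z. \<Sum>i=1..k. \<zeta> (Suc n) i z) \<circ> (\<lambda>x. \<lambda>(t, i)\<in>?B. \<xi> t i x))"
  proof (rule indep_var_compose)
    show "gw_process \<zeta> n \<in> measurable (PiM ?A ?C) (count_space UNIV)"
      by (rule measurable_gw_process) (auto intro: m\<zeta>)
    show "(\<lambda>z. \<Sum>i=1..k. \<zeta> (Suc n) i z) \<in> measurable (PiM ?B ?C) (count_space UNIV)"
      by (rule measurable_sum_count_space) (auto intro: m\<zeta>)
  qed
  moreover have "gw_process \<zeta> n \<circ> (\<lambda>x. \<lambda>(t, i)\<in>?A. \<xi> t i x) = gw_process \<xi> n"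
    by (auto simp: fun_eq_iff \<zeta>_def intro!: gw_process_cong)
  moreover have "(\<lambda>z. \<Sum>i=1..k. \<zeta> (Suc n) i z) \<circ> (\<lambda>x. \<lambda>(t, i)\<in>?B. \<xi> t i x)
      = (\<lambda>x. \<Sum>i=1..k. \<xi> (Suc n) i x)"
    by (auto simp: fun_eq_iff \<zeta>_def)
  ultimately show ?thesis by simp
qed

lemma indep_generation:
  assumes "1 \<le> t"
  shows "indep_vars (\<lambda>_. count_space UNIV) (\<xi> t) {1..}"
proof -
  have "indep_vars ((\<lambda>_. count_space UNIV) \<circ> Pair t) ((\<lambda>(t, i). \<xi> t i) \<circ> Pair t) {1..}"
    by (rule indep_vars_reindex[OF indep_offspring]) (use assms in \<open>auto simp: inj_on_def\<close>)
  then show ?thesis by (simp add: comp_def)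
qed

text \<open>Induction that splits off the last generation, which replaces \<open>s\<close> by its
  image under the last generating function; hence \<open>s\<close> is arbitrary. The affine image of
  \<open>odds s\<close> supplies the next summand and the next factor of the product.\<close>

lemma odds_pgf_gw_process:
  assumes range: "\<And>t. 1 \<le> t \<Longrightarrow> p t \<in> {0<..<1} \<and> \<alpha> t \<in> {0<..<1}" and s: "s \<in> {0..<1}"
  shows "expectation (\<lambda>x. s ^ gw_process \<xi> n x) \<in> {0..<1} \<and>
    odds (expectation (\<lambda>x. s ^ gw_process \<xi> n x)) =
      (\<Sum>i<n. \<alpha> (Suc i) / (1 - \<alpha> (Suc i)) * (\<Prod>j=1..i. p j / (1 - \<alpha> j)))
        + (\<Prod>j=1..n. p j / (1 - \<alpha> j)) * odds s"
  using s
proof (induction n arbitrary: s)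
  case 0
  then show ?case by (simp add: prob_space)
next
  case (Suc n)
  let ?f = "gen_geometric_pgf (p (Suc n)) (\<alpha> (Suc n))"
  have r: "p (Suc n) \<in> {0<..<1}" "\<alpha> (Suc n) \<in> {0<..<1}" using range[of "Suc n"] by auto
  have f: "?f s \<in> {0..<1}" using gen_geometric_pgf_range[OF r Suc.prems] .
  have "expectation (\<lambda>x. s ^ gw_process \<xi> (Suc n) x) = expectation (\<lambda>x. ?f s ^ gw_process \<xi> n x)"
    unfolding gw_process.simps
  proof (rule expectation_power_random_sum[OF indep_gw_process_offspring indep_generation])
    fix i :: nat assume i: "1 \<le> i"
    show "expectation (\<lambda>x. s ^ \<xi> (Suc n) i x) = ?f s"
      by (rule expectation_power_gen_geometric[OF measurable_offspring r(1) Suc.prems])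
        (use i offspring_0 offspring_pos in auto)
  qed (use Suc.prems in auto)
  then show ?case
    using Suc.IH[OF f] by (simp add: odds_gen_geometric_pgf[OF r Suc.prems] algebra_simps)
qed

text \<open>Taking \<open>s = 0\<close> above makes the survival probability at time n the
  reciprocal of a partial sum of \<open>S_infty\<close>. A positive probability of surviving forever
  would bound these partial sums.\<close>

lemma dies_out_if_S_infty:
  assumes range: "\<And>t. 1 \<le> t \<Longrightarrow> p t \<in> {0<..<1} \<and> \<alpha> t \<in> {0<..<1}"
    and S: "S_infty p (\<lambda>t. 1 - \<alpha> t) = \<infinity>"
  shows "dies_out_as Q (gw_process \<xi>)"
proof -
  define a where "a i = \<alpha> (Suc i) / (1 - \<alpha> (Suc i)) * (\<Prod>j=1..i. p j / (1 - \<alpha> j))" for i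
  have a0: "a i \<ge> 0" for i
    unfolding a_def using range by (intro mult_nonneg_nonneg prod_nonneg divide_nonneg_nonneg) (auto simp: less_imp_le)
  have mN[measurable]: "gw_process \<xi> n \<in> measurable Q (count_space UNIV)" for n
    by (rule measurable_gw_process) (rule measurable_offspring)
  have surv: "prob {x \<in> space Q. gw_process \<xi> n x \<noteq> 0} = 1 / (1 + (\<Sum>i<n. a i))" for n
  proof -
    \<comment> \<open>Since \<open>0 ^ 0 = 1\<close>, this power is the indicator of extinction by
      time n.\<close>
    let ?G = "expectation (\<lambda>x. (0::real) ^ gw_process \<xi> n x)"
    have "?G = expectation (indicator {x \<in> space Q. gw_process \<xi> n x = 0})"
      by (rule Bochner_Integration.integral_cong) (auto simp: indicator_def)
    then have G: "?G = prob {x \<in> space Q. gw_process \<xi> n x = 0}" by simp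
    have "prob {x \<in> space Q. gw_process \<xi> n x \<noteq> 0} = 1 - ?G"
      unfolding G by (subst prob_neg[symmetric]) auto
    moreover have "?G < 1" "odds ?G = (\<Sum>i<n. a i)"
      using odds_pgf_gw_process[OF range, of 0 n] by (auto simp: a_def odds_def)
    moreover have "1 + ?G / (1 - ?G) = 1 / (1 - ?G)"
      using \<open>?G < 1\<close> by (simp add: divide_simps)
    ultimately show ?thesis by (simp add: odds_def)
  qed
  have ainf: "\<not> summable a"
  proof
    assume "summable a"
    then have "(\<Sum>i. ennreal (a i)) < \<infinity>" using a0 by (simp add: suminf_ennreal2)
    moreover have "S_infty p (\<lambda>t. 1 - \<alpha> t) = 1 + (\<Sum>i. ennreal (a i))"
      by (simp add: S_infty_def a_def)
    ultimately show False using S by (metis ennreal_add_eq_top ennreal_one_neq_top infinity_ennreal_def less_irrefl)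
  qed
  let ?E = "{x \<in> space Q. \<forall>n. gw_process \<xi> n x \<noteq> 0}"
  have E0: "prob ?E = 0"
  proof (rule ccontr)
    assume "prob ?E \<noteq> 0"
    then have pos: "prob ?E > 0" using measure_nonneg[of Q ?E] by linarith
    have "(\<Sum>i<n. a i) \<le> 1 / prob ?E" for n
    proof -
      have "prob ?E \<le> prob {x \<in> space Q. gw_process \<xi> n x \<noteq> 0}"
        by (rule finite_measure_mono) auto
      moreover have "(\<Sum>i<n. a i) \<ge> 0" by (simp add: sum_nonneg a0)
      ultimately have "prob ?E * (1 + (\<Sum>i<n. a i)) \<le> 1"
        unfolding surv by (simp add: pos_le_divide_eq)
      then have "prob ?E * (\<Sum>i<n. a i) \<le> 1" using pos unfolding distrib_left by linarith
      then show ?thesis using pos by (simp add: pos_le_divide_eq mult.commute)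
    qed
    then have "summable a" by (intro summableI_nonneg_bounded) (auto simp: a0)
    with ainf show False ..
  qed
  \<comment> \<open>The extinction time. The case split avoids \<open>LEAST\<close> of an
    unsatisfiable predicate.\<close>
  define \<tau> where "\<tau> x = (if \<exists>n. gw_process \<xi> n x = 0
    then enat (LEAST n. gw_process \<xi> n x = 0) else \<infinity>)" for x
  show ?thesis
    unfolding dies_out_as_def
  proof (intro exI[of _ \<tau>] conjI ballI allI impI)
    show "\<tau> \<in> measurable Q (count_space UNIV)"
      unfolding \<tau>_def by measurable
    have "AE x in Q. \<not> (\<forall>n. gw_process \<xi> n x \<noteq> 0)"
      using E0 by (subst AE_iff_measurable[OF _ refl]) (auto simp: emeasure_eq_measure)
    then show "AE x in Q. \<tau> x < \<infinity>"
      by eventually_elim (auto simp: \<tau>_def)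
    fix x t assume "\<tau> x \<le> enat t"
    then have ex: "\<exists>n. gw_process \<xi> n x = 0" by (cases "\<exists>n. gw_process \<xi> n x = 0") (auto simp: \<tau>_def)
    with \<open>\<tau> x \<le> enat t\<close> have least: "(LEAST n. gw_process \<xi> n x = 0) \<le> t"
      unfolding \<tau>_def by simp
    show "gw_process \<xi> t x = 0"
      by (rule gw_process_eq_0_mono[OF LeastI_ex[OF ex] least])
  qed
qed

end

section \<open>Mean-zero differences and shifts of i.i.d. sequences\<close>

text \<open>
  The two variables need not be integrable themselves; the difference of their truncations has
  mean zero and is bounded below by \<open>- g\<close>, so Fatou's lemma makes \<open>Y - Y'\<close> integrable, and
  dominated convergence gives its mean.
\<close>

lemma (in prob_space) expectation_diff_eq_distr:
  fixes Y Y' g :: "'a \<Rightarrow> real"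
  assumes [measurable]: "random_variable borel Y" "random_variable borel Y'"
    and distr: "distr M borel Y = distr M borel Y'"
    and g: "integrable M g" and lower: "\<And>x. x \<in> space M \<Longrightarrow> - g x \<le> Y x - Y' x"
    and g0: "\<And>x. x \<in> space M \<Longrightarrow> 0 \<le> g x"
  shows "integrable M (\<lambda>x. Y x - Y' x)" and "expectation (\<lambda>x. Y x - Y' x) = 0"
proof -
  have [measurable]: "g \<in> borel_measurable M" using g by simp
  define c where "c n y = max (- real n) (min (real n) y)" for n and y :: real
  have [measurable]: "c n \<in> borel_measurable borel" for n unfolding c_def by measurable
  define D where "D x = Y x - Y' x" for x
  define Dn where "Dn n x = c n (Y x) - c n (Y' x)" for n x
  have [measurable]: "D \<in> borel_measurable M" "Dn n \<in> borel_measurable M" for n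
    unfolding D_def Dn_def by measurable
  have int_c: "integrable M (\<lambda>x. c n (Z x))" if [measurable]: "random_variable borel Z" for n Z
    by (rule integrable_const_bound[where B = "real n"]) (auto simp: c_def)
  have Dn0: "expectation (Dn n) = 0" for n
  proof -
    have "expectation (\<lambda>x. c n (Y x)) = expectation (\<lambda>x. c n (Y' x))"
      using integral_distr[of Y M borel "c n"] integral_distr[of Y' M borel "c n"] distr by simp
    then show ?thesis unfolding Dn_def using int_c by simp
  qed
  have int_Dn: "integrable M (Dn n)" for n
    unfolding Dn_def using int_c by simp
  have lim: "(\<lambda>n. Dn n x) \<longlonglongrightarrow> D x" for x
  proof (rule tendsto_eventually)
    obtain m where "\<bar>Y x\<bar> \<le> real m" "\<bar>Y' x\<bar> \<le> real m"
      using real_arch_simple[of "max \<bar>Y x\<bar> \<bar>Y' x\<bar>"] by auto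
    then show "\<forall>\<^sub>F n in sequentially. Dn n x = D x"
      by (intro eventually_sequentiallyI[of m]) (auto simp: Dn_def D_def c_def)
  qed
  \<comment> \<open>Clamping is monotone and 1-Lipschitz, so \<open>Dn n x\<close> has the sign of
    \<open>D x\<close> and at most its size; as \<open>g\<close> is nonnegative, the lower bound
    survives.\<close>
  have contr: "\<bar>Dn n x\<bar> \<le> \<bar>D x\<bar>" and lowerN: "x \<in> space M \<Longrightarrow> - g x \<le> Dn n x" for n x
    using lower[of x] g0[of x] by (auto simp: Dn_def D_def c_def)
  have int_Dg: "integrable M (\<lambda>x. D x + g x)"
  proof (rule integrableI_nonneg)
    have "(\<integral>\<^sup>+x. ennreal (D x + g x) \<partial>M) = (\<integral>\<^sup>+x. liminf (\<lambda>n. ennreal (Dn n x + g x)) \<partial>M)"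
      by (intro nn_integral_cong lim_imp_Liminf[symmetric] tendsto_ennrealI tendsto_add lim) auto
    also have "\<dots> \<le> liminf (\<lambda>n. \<integral>\<^sup>+x. ennreal (Dn n x + g x) \<partial>M)"
      by (rule nn_integral_liminf) auto
    also have "(\<lambda>n. \<integral>\<^sup>+x. ennreal (Dn n x + g x) \<partial>M) = (\<lambda>n. ennreal (expectation g))"
    proof
      fix n
      have "0 \<le> Dn n x + g x" if "x \<in> space M" for x
        using lowerN[OF that, of n] by simp
      then have "(\<integral>\<^sup>+x. ennreal (Dn n x + g x) \<partial>M) = ennreal (expectation (\<lambda>x. Dn n x + g x))"
        using int_Dn g by (intro nn_integral_eq_integral AE_I2) auto
      also have "expectation (\<lambda>x. Dn n x + g x) = expectation g"
        using int_Dn g Dn0 by simp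
      finally show "(\<integral>\<^sup>+x. ennreal (Dn n x + g x) \<partial>M) = ennreal (expectation g)" .
    qed
    finally show "(\<integral>\<^sup>+x. ennreal (D x + g x) \<partial>M) < \<infinity>"
      by (simp add: Liminf_const le_less_trans)
  qed (use lower in \<open>auto simp: D_def algebra_simps\<close>)
  then have int_D: "integrable M D"
    using Bochner_Integration.integrable_diff[OF int_Dg g] by simp
  then show "integrable M (\<lambda>x. Y x - Y' x)" by (simp add: D_def[abs_def])
  have "(\<lambda>n. expectation (Dn n)) \<longlonglongrightarrow> expectation D"
    by (rule integral_dominated_convergence[where w = "\<lambda>x. \<bar>D x\<bar>"])
      (use int_D lim contr in auto)
  then have "expectation D = 0" by (simp add: Dn0 LIMSEQ_const_iff)
  then show "expectation (\<lambda>x. Y x - Y' x) = 0" by (simp add: D_def[abs_def])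
qed

text \<open>By independence each sequence has the product of its marginals as law, and all the
  marginals coincide.\<close>

lemma (in prob_space) iid_distr_shift:
  fixes V :: "nat \<Rightarrow> 'a \<Rightarrow> 'b"
  assumes indep: "indep_vars (\<lambda>_. N) V UNIV"
    and ident: "\<And>i. distr M N (V i) = distr M N (V 0)"
  shows "distr M (PiM UNIV (\<lambda>_. N)) (\<lambda>x i. V (Suc i) x) = distr M (PiM UNIV (\<lambda>_. N)) (\<lambda>x i. V i x)"
proof -
  have rv: "random_variable N (V i)" for i using indep by (auto simp: indep_vars_def)
  have "indep_vars ((\<lambda>_. N) \<circ> Suc) (V \<circ> Suc) UNIV"
    by (rule indep_vars_reindex[OF indep]) auto
  then have indep': "indep_vars (\<lambda>_. N) (\<lambda>i. V (Suc i)) UNIV" by (simp add: comp_def)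
  have 1: "distr M (PiM UNIV (\<lambda>_. N)) (\<lambda>x i. W i x) = PiM UNIV (\<lambda>i. distr M N (W i))"
    if "indep_vars (\<lambda>_. N) W UNIV" "\<And>i. random_variable N (W i)" for W :: "nat \<Rightarrow> 'a \<Rightarrow> 'b"
    using that by (subst (asm) indep_vars_iff_distr_eq_PiM) (auto simp: restrict_def)
  have "PiM UNIV (\<lambda>i. distr M N (V (Suc i))) = PiM UNIV (\<lambda>i. distr M N (V i))"
    by (metis ident)
  then show ?thesis using 1[OF indep'] 1[OF indep] rv by simp
qed

lemma (in prob_space) indep_var_shift:
  fixes V :: "nat \<Rightarrow> 'a \<Rightarrow> 'b"
  assumes indep: "indep_vars (\<lambda>_. N) V UNIV"
    and f: "f \<in> measurable N L" and h: "h \<in> measurable (PiM UNIV (\<lambda>_. N)) L'"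
  shows "indep_var L (\<lambda>x. f (V 0 x)) L' (\<lambda>x. h (\<lambda>i. V (Suc i) x))"
proof -
  have "indep_var (PiM {0} (\<lambda>_. N)) (\<lambda>x. \<lambda>i\<in>{0}. V i x) (PiM {1..} (\<lambda>_. N)) (\<lambda>x. \<lambda>i\<in>{1..}. V i x)"
    by (rule indep_var_restrict[OF indep]) auto
  then have "indep_var L ((\<lambda>z. f (z 0)) \<circ> (\<lambda>x. \<lambda>i\<in>{0}. V i x))
      L' ((\<lambda>z. h (\<lambda>i. z (Suc i))) \<circ> (\<lambda>x. \<lambda>i\<in>{1..}. V i x))"
  proof (rule indep_var_compose)
    show "(\<lambda>z. f (z 0)) \<in> measurable (PiM {0} (\<lambda>_. N)) L"
      by (rule measurable_compose[OF _ f]) (rule measurable_component_singleton, simp)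
    show "(\<lambda>z. h (\<lambda>i. z (Suc i))) \<in> measurable (PiM {1..} (\<lambda>_. N)) L'"
      by (intro measurable_compose[OF _ h] measurable_PiM_single')
        (auto intro!: measurable_component_singleton simp: space_PiM PiE_def Pi_def)
  qed
  then show ?thesis by (simp add: comp_def)
qed

section \<open>The random series and its almost sure divergence\<close>

text \<open>This is \<open>S_infty\<close> minus 1 as a functional of the pairs (p, \<alpha>), with
  \<open>v i\<close> holding time i + 1, so that the law of the sequence can be pushed through
  it.\<close>

definition perpetuity :: "(nat \<Rightarrow> real \<times> real) \<Rightarrow> ennreal" where
  "perpetuity v = (\<Sum>i. ennreal (snd (v i) / (1 - snd (v i)) * (\<Prod>j<i. fst (v j) / (1 - snd (v j)))))"

lemma measurable_perpetuity[measurable]: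
  "perpetuity \<in> borel_measurable (PiM UNIV (\<lambda>_. borel))"
proof -
  have "fst \<in> borel_measurable (borel :: (real \<times> real) measure)"
    and "snd \<in> borel_measurable (borel :: (real \<times> real) measure)"
    by (intro borel_measurable_continuous_onI continuous_intros)+
  then have [measurable]: "(\<lambda>v. fst (v i)) \<in> borel_measurable (PiM UNIV (\<lambda>_. borel :: (real \<times> real) measure))"
    "(\<lambda>v. snd (v i)) \<in> borel_measurable (PiM UNIV (\<lambda>_. borel :: (real \<times> real) measure))" for i :: nat
    by (auto intro!: measurable_compose[OF measurable_component_singleton])
  show ?thesis unfolding perpetuity_def by measurable
qed

text \<open>Split off the term 0 and pull the factor with j = 0 out of all later products. Working
  in \<open>ennreal\<close> covers the divergent case too.\<close>

lemma perpetuity_unfold: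
  assumes "\<And>i. fst (v i) \<in> {0<..<1}" "\<And>i. snd (v i) \<in> {0<..<1}"
  shows "perpetuity v = ennreal (snd (v 0) / (1 - snd (v 0)))
    + ennreal (fst (v 0) / (1 - snd (v 0))) * perpetuity (\<lambda>i. v (Suc i))"
proof -
  let ?a = "\<lambda>i. snd (v i) / (1 - snd (v i)) * (\<Prod>j<i. fst (v j) / (1 - snd (v j)))"
  let ?a' = "\<lambda>i. snd (v (Suc i)) / (1 - snd (v (Suc i))) * (\<Prod>j<i. fst (v (Suc j)) / (1 - snd (v (Suc j))))"
  have "?a (Suc i) = fst (v 0) / (1 - snd (v 0)) * ?a' i" for i
    by (subst prod.lessThan_Suc_shift) (simp add: mult_ac)
  moreover have "fst (v 0) / (1 - snd (v 0)) \<ge> 0" using assms[of 0] by auto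
  moreover have "?a' i \<ge> 0" for i
    using assms by (intro mult_nonneg_nonneg prod_nonneg divide_nonneg_nonneg) (auto simp: less_imp_le)
  ultimately have "ennreal (?a (Suc i)) = ennreal (fst (v 0) / (1 - snd (v 0))) * ennreal (?a' i)" for i
    by (simp only: ennreal_mult)
  then have "(\<Sum>i. ennreal (?a (Suc i))) = ennreal (fst (v 0) / (1 - snd (v 0))) * perpetuity (\<lambda>i. v (Suc i))"
    unfolding perpetuity_def by (simp only: ennreal_suminf_cmult)
  then show ?thesis
    using suminf_offset[of "\<lambda>i. ennreal (?a i)" 1]
    by (simp add: perpetuity_def del: prod.lessThan_Suc)
qed

context iid_environment
begin

lemma perpetuity_infinite_AE:
  assumes int: "integrable Pm (\<lambda>\<omega>. ln ((1 - \<alpha> 1 \<omega>) / p 1 \<omega>))"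
    and zero: "expectation (\<lambda>\<omega>. ln ((1 - \<alpha> 1 \<omega>) / p 1 \<omega>)) = 0"
  shows "AE \<omega> in Pm. perpetuity (\<lambda>i. (p (Suc i) \<omega>, \<alpha> (Suc i) \<omega>)) = \<infinity>"
proof -
  define V where "V i \<omega> = (p (Suc i) \<omega>, \<alpha> (Suc i) \<omega>)" for i \<omega>
  define \<phi> :: "real \<times> real \<Rightarrow> real" where "\<phi> v = ln ((1 - snd v) / fst v)" for v
  define X where "X \<omega> = \<phi> (V 0 \<omega>)" for \<omega>
  define T where "T \<omega> = perpetuity (\<lambda>i. V i \<omega>)" for \<omega>
  define T' where "T' \<omega> = perpetuity (\<lambda>i. V (Suc i) \<omega>)" for \<omega>
  \<comment> \<open>Default values matter: \<open>enn2real \<infinity> = 0\<close> and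
    \<open>ln 0 = 0\<close>, so \<open>L\<close> vanishes at infinity.\<close>
  define L where "L t = ln (enn2real t)" for t :: ennreal
  define ind where "ind t = indicat_real {..<\<infinity>} t" for t :: ennreal
  define D where "D \<omega> = L (T \<omega>) - L (T' \<omega>)" for \<omega>

  have [measurable]: "fst \<in> borel_measurable (borel :: (real \<times> real) measure)"
    and [measurable]: "snd \<in> borel_measurable (borel :: (real \<times> real) measure)"
    by (intro borel_measurable_continuous_onI continuous_intros)+
  have m\<phi>: "\<phi> \<in> borel_measurable borel"
    unfolding \<phi>_def by measurable
  have mL[measurable]: "L \<in> borel_measurable borel" unfolding L_def by measurable
  have mind[measurable]: "ind \<in> borel_measurable borel" unfolding ind_def by measurable

  have "indep_vars ((\<lambda>_. borel) \<circ> Suc) ((\<lambda>t \<omega>. (p t \<omega>, \<alpha> t \<omega>)) \<circ> Suc) UNIV"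
    by (rule indep_vars_reindex[OF indep_env]) auto
  then have indep: "indep_vars (\<lambda>_. borel) V UNIV"
    by (simp add: comp_def V_def[abs_def])
  have ident: "distr Pm borel (V i) = distr Pm borel (V 0)" for i
    using ident_env[of "Suc i"] by (simp add: V_def[abs_def])
  have [measurable]: "V i \<in> borel_measurable Pm" for i
    using indep by (auto simp: indep_vars_def)
  have mV[measurable]: "(\<lambda>\<omega> i. V i \<omega>) \<in> measurable Pm (PiM UNIV (\<lambda>_. borel))"
    "(\<lambda>\<omega> i. V (Suc i) \<omega>) \<in> measurable Pm (PiM UNIV (\<lambda>_. borel))"
    by (auto intro!: measurable_PiM_single')
  have T[measurable]: "T \<in> borel_measurable Pm" "T' \<in> borel_measurable Pm"
    unfolding T_def T'_def by measurable

  \<comment> \<open>\<open>T\<close> and \<open>T'\<close> are one functional applied to the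
    sequence and to its shift, which have the same law.\<close>
  have "distr Pm borel (\<lambda>\<omega>. L (T \<omega>)) =
      distr (distr Pm (PiM UNIV (\<lambda>_. borel)) (\<lambda>\<omega> i. V i \<omega>)) borel (\<lambda>v. L (perpetuity v))"
    by (subst distr_distr) (auto simp: comp_def T_def)
  also have "\<dots> = distr (distr Pm (PiM UNIV (\<lambda>_. borel)) (\<lambda>\<omega> i. V (Suc i) \<omega>)) borel (\<lambda>v. L (perpetuity v))"
    by (simp add: iid_distr_shift[OF indep ident])
  also have "\<dots> = distr Pm borel (\<lambda>\<omega>. L (T' \<omega>))"
    by (subst distr_distr) (auto simp: comp_def T'_def)
  finally have distr_eq: "distr Pm borel (\<lambda>\<omega>. L (T \<omega>)) = distr Pm borel (\<lambda>\<omega>. L (T' \<omega>))" .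

  have intX: "integrable Pm X" and X0: "expectation X = 0"
    using int zero by (simp_all add: X_def[abs_def] V_def \<phi>_def)

  have key: "(T' \<omega> = \<infinity> \<longrightarrow> T \<omega> = \<infinity>) \<and> (T' \<omega> < \<infinity> \<longrightarrow> T \<omega> < \<infinity> \<and> L (T' \<omega>) - X \<omega> < L (T \<omega>))"
    if \<omega>: "\<omega> \<in> space Pm" for \<omega>
  proof -
    have r: "fst (V i \<omega>) \<in> {0<..<1}" "snd (V i \<omega>) \<in> {0<..<1}" for i
      using p_range[OF _ \<omega>, of "Suc i"] \<alpha>_range[OF _ \<omega>, of "Suc i"] by (auto simp: V_def)
    define A where "A = snd (V 0 \<omega>) / (1 - snd (V 0 \<omega>))"
    define B where "B = fst (V 0 \<omega>) / (1 - snd (V 0 \<omega>))"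
    have AB: "A > 0" "B > 0" using r[of 0] by (auto simp: A_def B_def)
    have unfold1: "T \<omega> = ennreal A + ennreal B * T' \<omega>"
      unfolding T_def T'_def A_def B_def by (rule perpetuity_unfold) (use r in auto)
    have X: "X \<omega> = - ln B" using r[of 0] by (simp add: X_def \<phi>_def B_def ln_div)
    \<comment> \<open>Positivity makes \<open>L (T' \<omega>)\<close> a genuine logarithm when
      \<open>T' \<omega>\<close> is finite.\<close>
    have "T' \<omega> > 0"
    proof -
      have "0 < snd (V 1 \<omega>) / (1 - snd (V 1 \<omega>))" using r[of 1] by auto
      then have "0 < ennreal (snd (V 1 \<omega>) / (1 - snd (V 1 \<omega>)))" by simp
      also have "\<dots> \<le> T' \<omega>"
        unfolding T'_def by (subst perpetuity_unfold) (use r in auto)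
      finally show ?thesis .
    qed
    show ?thesis
    proof (cases "T' \<omega>")
      case top
      then show ?thesis using AB unfold1 by (simp add: ennreal_mult_top)
    next
      case (real t)
      then have t: "t > 0" using \<open>T' \<omega> > 0\<close> by simp
      have Tr: "T \<omega> = ennreal (A + B * t)"
        using AB t by (simp add: unfold1 real ennreal_mult ennreal_plus)
      \<comment> \<open>Strictness comes from \<open>A > 0\<close>; it is what later excludes finite
        values.\<close>
      have "0 < B * t" using AB t by simp
      then have "ln (B * t) < ln (A + B * t)" using AB by simp
      moreover have "ln (B * t) = ln B + ln t" using AB t by (simp add: ln_mult)
      moreover have "L (T \<omega>) = ln (A + B * t)" "L (T' \<omega>) = ln t"
        using AB t by (simp_all add: L_def Tr real del: ennreal_plus)
      ultimately show ?thesis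
        using t by (simp add: X Tr real)
    qed
  qed
  have L_top: "L \<infinity> = 0" by (simp add: L_def)
  have lower: "- \<bar>X \<omega>\<bar> \<le> L (T \<omega>) - L (T' \<omega>)" if "\<omega> \<in> space Pm" for \<omega>
    using key[OF that] L_top by (cases "T' \<omega> = \<infinity>") (auto simp: less_top)
  have LT: "(\<lambda>\<omega>. L (T \<omega>)) \<in> borel_measurable Pm" "(\<lambda>\<omega>. L (T' \<omega>)) \<in> borel_measurable Pm"
    by measurable
  have D: "integrable Pm D" "expectation D = 0"
    using expectation_diff_eq_distr[OF LT distr_eq, of "\<lambda>\<omega>. \<bar>X \<omega>\<bar>"] lower intX
    by (simp_all add: D_def[abs_def])

  \<comment> \<open>\<open>X\<close> depends on \<open>V 0\<close> only and \<open>T'\<close> on the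
    later pairs, so restricting \<open>X\<close> to finite \<open>T'\<close> keeps its mean
    zero.\<close>
  have indep_XT: "indep_var borel X borel (\<lambda>\<omega>. ind (T' \<omega>))"
    unfolding X_def T'_def
    by (rule indep_var_shift[OF indep m\<phi>, where h = "\<lambda>v. ind (perpetuity v)"]) measurable
  have "integrable Pm (\<lambda>\<omega>. ind (T' \<omega>))"
    by (rule integrable_const_bound[where B = 1]) (auto simp: ind_def indicator_def)
  from indep_var_lebesgue_integral[OF indep_XT intX this] indep_var_integrable[OF indep_XT intX this] X0
  have XB: "expectation (\<lambda>\<omega>. X \<omega> * ind (T' \<omega>)) = 0" "integrable Pm (\<lambda>\<omega>. X \<omega> * ind (T' \<omega>))"
    by simp_all

  \<comment> \<open>\<open>Z\<close> is 0 where \<open>T'\<close> is infinite and strictly positive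
    where it is finite; having mean zero, it vanishes almost surely.\<close>
  define Z where "Z \<omega> = D \<omega> + X \<omega> * ind (T' \<omega>)" for \<omega>
  have Z: "integrable Pm Z" "expectation Z = 0"
    unfolding Z_def using D XB by simp_all
  have Z_pos: "0 \<le> Z \<omega> \<and> (Z \<omega> = 0 \<longrightarrow> T \<omega> = \<infinity>)" if "\<omega> \<in> space Pm" for \<omega>
    using key[OF that] L_top
    by (cases "T' \<omega> = \<infinity>") (auto simp: less_top Z_def D_def ind_def)
  have "AE \<omega> in Pm. Z \<omega> = 0"
    using integral_nonneg_eq_0_iff_AE[OF Z(1)] Z(2) Z_pos by auto
  then have "AE \<omega> in Pm. T \<omega> = \<infinity>"
    by (rule AE_mp) (use Z_pos in auto)
  then show ?thesis by (simp add: T_def V_def)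
qed

end

theorem theorem3p5:
  fixes Pm :: "'e measure" and p \<alpha> \<beta> :: "nat \<Rightarrow> 'e \<Rightarrow> real"
    and Q :: "'e \<Rightarrow> 'w measure" and \<xi> :: "nat \<Rightarrow> nat \<Rightarrow> 'w \<Rightarrow> nat"
  assumes env: "iid_environment Pm p \<alpha>"
    and beta: "\<And>t \<omega>. \<beta> t \<omega> = 1 - \<alpha> t \<omega>"
    and quenched: "\<And>\<omega>. \<omega> \<in> space Pm \<Longrightarrow>
      quenched_offspring (Q \<omega>) (\<lambda>t. p t \<omega>) (\<lambda>t. \<alpha> t \<omega>) \<xi>"
    and log_integrable: "integrable Pm (\<lambda>\<omega>. ln (\<beta> 1 \<omega> / p 1 \<omega>))"
    and mean_zero: "(\<integral>\<omega>. ln (\<beta> 1 \<omega> / p 1 \<omega>) \<partial>Pm) = 0"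
    and finite_variance: "integrable Pm (\<lambda>\<omega>. (ln (\<beta> 1 \<omega> / p 1 \<omega>))\<^sup>2)"
  shows "AE \<omega> in Pm.
    S_infty (\<lambda>t. p t \<omega>) (\<lambda>t. \<beta> t \<omega>) = \<infinity> \<and> dies_out_as (Q \<omega>) (gw_process \<xi>)"
proof -
  interpret iid_environment Pm p \<alpha> by (rule env)
  have "AE \<omega> in Pm. perpetuity (\<lambda>i. (p (Suc i) \<omega>, \<alpha> (Suc i) \<omega>)) = \<infinity>"
    using log_integrable mean_zero by (intro perpetuity_infinite_AE) (simp_all add: beta)
  then show ?thesis
    using AE_space
  proof eventually_elim
    case (elim \<omega>)
    \<comment> \<open>Only the indexing differs: the product over \<open>1..i\<close> becomes one
      over \<open>j < i\<close> of the shifted sequence.\<close>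
    have "S_infty (\<lambda>t. p t \<omega>) (\<lambda>t. 1 - \<alpha> t \<omega>) = 1 + perpetuity (\<lambda>i. (p (Suc i) \<omega>, \<alpha> (Suc i) \<omega>))"
      unfolding S_infty_def perpetuity_def
      by (simp add: prod.atLeast1_atMost_eq)
    then have S: "S_infty (\<lambda>t. p t \<omega>) (\<lambda>t. 1 - \<alpha> t \<omega>) = \<infinity>"
      using elim by simp
    have Q: "quenched_offspring (Q \<omega>) (\<lambda>t. p t \<omega>) (\<lambda>t. \<alpha> t \<omega>) \<xi>"
      using quenched elim by blast
    have "dies_out_as (Q \<omega>) (gw_process \<xi>)"
      using p_range \<alpha>_range elim
      by (intro quenched_offspring.dies_out_if_S_infty[OF Q _ S]) blast
    with S show ?case by (simp add: beta)
  qed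
qed

end
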